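(* Let $\mathcal{P}$ be the model space, with orthogonal projections $\widehat P$ onto $\mathcal{P}$ and $\widehat Q$ onto $\mathcal{Q}=\mathcal{H}\ominus\mathcal{P}$, as described in the context. Suppose that for each $n$ the $n$-body part of the wave operator $\widehat\Omega$ is $$\widehat{\Omega}_{n}=\sum_{\alpha_i,\beta_j}\widehat{Q}\,\widehat{O}_{n}(\alpha\bar{\beta})\,\widehat{P}\;\omega_{\alpha_{1}\ldots\alpha_{n}\bar{\beta}_{1}\ldots\bar{\beta}_{n}},\qquad \widehat{O}_{n}(\alpha\bar{\beta})=a_{\alpha_{1}}a_{\alpha_{2}}\cdots a_{\alpha_{n}}a_{\bar{\beta}_{n}}^{\dagger}\cdots a_{\bar{\beta}_{2}}^{\dagger}a_{\bar{\beta}_{1}}^{\dagger},$$ where the sum runs over one-electron orbitals of all three types (excited, valence, core) and the $\omega$'s are scalar coefficients. Let $$W=\sum_{n}\sum_{\xi\le 4}W_{n,\xi},\qquad W_{n,\xi}=\{\widehat{P}(V_{1}+V_{2})\widehat{\Omega}_{n}\widehat{P}\}_{\xi}$$ be the effective interaction operator on $\mathcal{P}$. Then for every $n\geq 2$ the nonzero terms of $W$ arising from $\widehat\Omega_n$ are generated by at most eight types of the Fock space operators $\widehat O_n(\alpha\bar\beta)$; that is, there are at most eight types such that every operator $\widehat O_n(\alpha\bar\beta)$ giving a nonzero contribution to some $W_{n,\xi}$, $\xi\in\{1,2,3,4\}$, has one of these types.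
   Context: Orbitals. The one-electron orbitals are divided into three disjoint types: core ($\mathrm{c}$), valence ($\mathrm{v}$) and excited or virtual ($\mathrm{e}$). For an orbital $\alpha$, $a_\alpha$ denotes the fermionic creation operator and $a_{\alpha}^{\dagger}$ the fermionic annihilation operator (note this convention: the undaggered operator creates). A bar over an orbital label only marks orbitals attached to annihilation operators. Each orbital $\alpha$ has an orbital angular momentum quantum number $l_\alpha\in\{0,1,2,\dots\}$. Hilbert space and model space. $\mathcal{H}$ is the separable $N$-electron Hilbert space with an orthonormal basis of configuration state functions (eigenfunctions of a central-field Hamiltonian $H_0$), each having a parity $\pm1$. The model space $\mathcal{P}\subset\mathcal{H}$ has finite dimension $d$ and is spanned by basis functions $\phi_1,\dots,\phi_d$, all of the same parity $\Pi^{Y}$, built only of core and valence orbitals: the core orbitals are occupied, no excited orbital is occupied, and the set $\{\phi_k\}$ is complete in the sense that the valence electrons are allocated among the valence orbitals in all possible ways compatible with the parity $\Pi^Y$. $\mathcal{Q}$ is the orthogonal complement of $\mathcal{P}$, and $\widehat P=\sum_{k=1}^d\phi_k\phi_k^\dagger$, $\widehat Q=\widehat{\mathbf 1}-\widehat P$. One has $$a_{\mathrm c}\widehat P=0,\qquad a^{\dagger}_{\bar{\mathrm e}}\widehat P=0,\qquad a_{\mathrm v}\widehat P\neq0,\qquad a^{\dagger}_{\bar{\mathrm v}}\widehat P\neq0 .$$ Standing parity selection rule. When all $\alpha_i$ and all $\bar\beta_j$ are valence orbitals, one always has $\widehat Q\widehat O_n(\alpha\bar\beta)\widehat P=0$.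 (This is guaranteed when $\sum_{i=1}^n(l_{\alpha_i}+l_{\bar\beta_i})$ is even; all-valence operators not satisfying this parity condition are excluded from $\widehat\Omega_n$.) Perturbation and contractions. $V=V_1+V_2$ is the perturbation, with one-body part $V_1$ (a linear combination of operators $a_\alpha a_{\bar\beta}^\dagger$) and two-body part $V_2$ (a linear combination of operators $a_{\alpha}a_{\beta}a^\dagger_{\bar\nu}a^\dagger_{\bar\mu}$), the orbitals being of any type. The operators $V_1,V_2$ and $\widehat O_n(\alpha\bar\beta)$ are understood in normal order (Wick's theorem) with respect to the core determinant (all core orbitals occupied, all valence and excited orbitals empty). $\{\,\cdot\,\}_\xi$ denotes the sum of those terms in the Wick expansion of the product that have exactly $\xi$ contractions between the operators of $V_i$ ($i=1,2$) and those of the $n$-body operator (with $n+i-\xi\ge0$). The contribution of an individual $\widehat O_n(\alpha\bar\beta)$ to $W_{n,\xi}$ is $\omega\,\widehat P\{(V_1+V_2)\widehat O_n(\alpha\bar\beta)\}_\xi\widehat P$ if $\widehat Q\widehat O_n(\alpha\bar\beta)\widehat P\ne0$, and is $0$ if $\widehat Q\widehat O_n(\alpha\bar\beta)\widehat P=0$. Types. The type of $\widehat O_n(\alpha\bar\beta)$ is the pair consisting of the multiset of orbital types (in $\{\mathrm e,\mathrm v,\mathrm c\}$) of $\alpha_1,\dots,\alpha_n$ and the multiset of orbital types of $\bar\beta_1,\dots,\bar\beta_n$ (the order within each group is irrelevant because of the anticommutation relations). *)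

theory Defs
  imports "HOL-Analysis.Infinite_Sum" "HOL-Library.Multiset" "HOL-Library.Countable"
    "HOL-Combinatorics.Permutations"
begin

datatype orbital_type = Exc | Val | Core

text \<open>A state is given by its amplitudes on Slater determinants, a Slater determinant being the
  set of its occupied orbitals. The linear order on orbitals only fixes the determinant phases.\<close>

type_synonym 'o state = "'o set \<Rightarrow> complex"

definition slater :: "'o set \<Rightarrow> 'o state" where
  "slater S = (\<lambda>S'. if S' = S then 1 else 0)"

definition inner_prod :: "'o state \<Rightarrow> 'o state \<Rightarrow> complex" where
  "inner_prod \<phi> \<psi> = (\<Sum>\<^sub>\<infinity>S. cnj (\<phi> S) * \<psi> S)"

text \<open>Following the convention that undaggered operators create, \<open>Cre \<alpha>\<close> stands for
  \<open>a\<^sub>\<alpha>\<close> and \<open>Ann \<beta>\<close> for the adjoint of \<open>a\<^sub>\<beta>\<close>.\<close>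

datatype 'o ladder = Cre 'o | Ann 'o

definition phase :: "'o::linorder \<Rightarrow> 'o set \<Rightarrow> complex" where
  "phase \<alpha> S = (-1) ^ card {\<beta> \<in> S. \<beta> < \<alpha>}"

fun ladder_op :: "'o::linorder ladder \<Rightarrow> 'o state \<Rightarrow> 'o state" where
  "ladder_op (Cre \<alpha>) \<psi> = (\<lambda>S. if \<alpha> \<in> S then phase \<alpha> S * \<psi> (S - {\<alpha>}) else 0)"
| "ladder_op (Ann \<alpha>) \<psi> = (\<lambda>S. if \<alpha> \<notin> S then phase \<alpha> S * \<psi> (insert \<alpha> S) else 0)"

text \<open>The leftmost operator of the string acts last.\<close>

definition string_op :: "'o::linorder ladder list \<Rightarrow> 'o state \<Rightarrow> 'o state" where
  "string_op xs \<psi> = foldr ladder_op xs \<psi>"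

text \<open>The sign of the permutation that lists \<open>0, \<dots>, length L - 1\<close> in the order \<open>L\<close>.\<close>

definition reorder_sign :: "nat list \<Rightarrow> complex" where
  "reorder_sign L = of_int (sign (\<lambda>i. if i < length L then L ! i else i))"

record 'o atom =
  kind :: "'o \<Rightarrow> orbital_type"
  ang :: "'o \<Rightarrow> nat"
  energy :: "'o \<Rightarrow> real"
  electrons :: nat
  csf_index :: "nat set"
  csf :: "nat \<Rightarrow> 'o state"
  model_dim :: nat
  model_parity :: int

definition core :: "'o atom \<Rightarrow> 'o set" where
  "core M = {\<alpha>. kind M \<alpha> = Core}"

definition hilbert_space :: "'o atom \<Rightarrow> 'o state set" where
  "hilbert_space M = {\<psi>. (\<forall>S. \<psi> S \<noteq> 0 \<longrightarrow> finite S \<and> card S = electrons M)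
      \<and> (\<lambda>S. (cmod (\<psi> S))\<^sup>2) summable_on UNIV}"

definition config_parity :: "'o atom \<Rightarrow> 'o set \<Rightarrow> int" where
  "config_parity M S = (-1) ^ (\<Sum>\<alpha>\<in>S. ang M \<alpha>)"

definition has_parity :: "'o atom \<Rightarrow> int \<Rightarrow> 'o state \<Rightarrow> bool" where
  "has_parity M p \<psi> \<longleftrightarrow> (\<forall>S. \<psi> S \<noteq> 0 \<longrightarrow> config_parity M S = p)"

text \<open>The central-field Hamiltonian \<open>H\<^sub>0\<close>, for which the orbitals are the one-electron
  eigenfunctions.\<close>

definition H0 :: "'o atom \<Rightarrow> 'o state \<Rightarrow> 'o state" where
  "H0 M \<psi> = (\<lambda>S. of_real (\<Sum>\<alpha>\<in>S. energy M \<alpha>) * \<psi> S)"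

text \<open>All ways to fill the core and to distribute the remaining electrons over the valence
  orbitals compatibly with the parity of the model space.\<close>

definition model_configs :: "'o atom \<Rightarrow> 'o set set" where
  "model_configs M = {S. finite S \<and> card S = electrons M \<and> core M \<subseteq> S
      \<and> (\<forall>\<alpha>\<in>S. kind M \<alpha> \<noteq> Exc) \<and> config_parity M S = model_parity M}"

definition atomic_system :: "'o atom \<Rightarrow> bool" where
  "atomic_system M \<longleftrightarrow>
    finite (core M) \<and>
    \<comment> \<open>orthonormal basis of configuration state functions\<close>
    (\<forall>k\<in>csf_index M. csf M k \<in> hilbert_space M) \<and>
    (\<forall>j\<in>csf_index M. \<forall>k\<in>csf_index M.
        inner_prod (csf M j) (csf M k) = (if j = k then 1 else 0)) \<and>
    (\<forall>\<psi>\<in>hilbert_space M. (\<forall>k\<in>csf_index M. inner_prod (csf M k) \<psi> = 0) \<longrightarrow> \<psi> = (\<lambda>S. 0)) \<and>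
    (\<forall>k\<in>csf_index M. \<exists>E::real. H0 M (csf M k) = (\<lambda>S. of_real E * csf M k S)) \<and>
    (\<forall>k\<in>csf_index M. \<exists>p\<in>{1, -1}. has_parity M p (csf M k)) \<and>
    \<comment> \<open>the members \<open>1, \<dots>, d\<close> span the complete model space\<close>
    {1..model_dim M} \<subseteq> csf_index M \<and>
    model_parity M \<in> {1, -1} \<and>
    (\<forall>k\<in>{1..model_dim M}. \<forall>S. csf M k S \<noteq> 0 \<longrightarrow> S \<in> model_configs M) \<and>
    (\<forall>S\<in>model_configs M. \<exists>c. slater S = (\<lambda>S'. \<Sum>k=1..model_dim M. c k * csf M k S'))"

definition projP :: "'o atom \<Rightarrow> 'o state \<Rightarrow> 'o state" where
  "projP M \<psi> = (\<lambda>S. \<Sum>k=1..model_dim M. inner_prod (csf M k) \<psi> * csf M k S)"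

definition projQ :: "'o atom \<Rightarrow> 'o state \<Rightarrow> 'o state" where
  "projQ M \<psi> = (\<lambda>S. \<psi> S - projP M \<psi> S)"

text \<open>Normal order and contractions with respect to the core determinant. The first notion below
  collects the operators whose adjoint annihilates the core determinant.\<close>

fun quasi_creator :: "'o atom \<Rightarrow> 'o ladder \<Rightarrow> bool" where
  "quasi_creator M (Cre \<alpha>) \<longleftrightarrow> kind M \<alpha> \<noteq> Core"
| "quasi_creator M (Ann \<alpha>) \<longleftrightarrow> kind M \<alpha> = Core"

definition normal_ordered :: "'o::linorder atom \<Rightarrow> 'o ladder list \<Rightarrow> 'o state \<Rightarrow> 'o state" where
  "normal_ordered M xs \<psi> =
    (let L = filter (\<lambda>i. quasi_creator M (xs ! i)) [0..<length xs]
           @ filter (\<lambda>i. \<not> quasi_creator M (xs ! i)) [0..<length xs]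
     in (\<lambda>S. reorder_sign L * string_op (map ((!) xs) L) \<psi> S))"

definition contraction :: "'o::linorder atom \<Rightarrow> 'o ladder \<Rightarrow> 'o ladder \<Rightarrow> complex" where
  "contraction M x y = inner_prod (slater (core M)) (string_op [x, y] (slater (core M)))"

text \<open>Sets of \<open>\<xi>\<close> disjoint pairs, each joining a position of a left string of length \<open>p\<close> to
  a position of a right string of length \<open>q\<close>. There are no pairs inside one string, since both
  factors of a product are already normal ordered.\<close>

definition pairings :: "nat \<Rightarrow> nat \<Rightarrow> nat \<Rightarrow> (nat \<times> nat) set set" where
  "pairings p q \<xi> = {\<mu>. \<mu> \<subseteq> {..<p} \<times> {..<q} \<and> card \<mu> = \<xi> \<and> inj_on fst \<mu> \<and> inj_on snd \<mu>}"

text \<open>One term of the Wick expansion of the product of the normal-ordered strings \<open>A\<close> and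
  \<open>B\<close>: the contracted pairs are moved to the front of \<open>A @ B\<close>, which yields the sign, and
  the uncontracted operators remain in normal order.\<close>

definition wick_term ::
  "'o::linorder atom \<Rightarrow> 'o ladder list \<Rightarrow> 'o ladder list \<Rightarrow> (nat \<times> nat) set \<Rightarrow> 'o state \<Rightarrow> 'o state" where
  "wick_term M A B \<mu> \<psi> =
    (let p = length A; q = length B;
         free = filter (\<lambda>i. i \<notin> fst ` \<mu> \<and> i \<notin> (+) p ` snd ` \<mu>) [0..<p + q];
         front = concat (map (\<lambda>i. [i, p + (THE j. (i, j) \<in> \<mu>)]) (sorted_list_of_set (fst ` \<mu>)))
     in (\<lambda>S. reorder_sign (front @ free) * (\<Prod>(i, j)\<in>\<mu>. contraction M (A ! i) (B ! j))
             * normal_ordered M (map ((!) (A @ B)) free) \<psi> S))"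

definition wick :: "'o::linorder atom \<Rightarrow> nat \<Rightarrow> 'o ladder list \<Rightarrow> 'o ladder list \<Rightarrow> 'o state \<Rightarrow> 'o state" where
  "wick M \<xi> A B \<psi> = (\<lambda>S. \<Sum>\<mu>\<in>pairings (length A) (length B) \<xi>. wick_term M A B \<mu> \<psi> S)"

text \<open>\<open>{(V\<^sub>1 + V\<^sub>2) B}\<^sub>\<xi>\<close>, where \<open>V\<^sub>1\<close> and \<open>V\<^sub>2\<close> have the coefficients \<open>v1\<close> and \<open>v2\<close>.
  For \<open>\<psi>\<close> in the model space and each \<open>S\<close> only finitely many summands are nonzero, so
  the coefficients are not restricted by any convergence condition.\<close>

definition wick_V ::
  "'o::linorder atom \<Rightarrow> ('o \<Rightarrow> 'o \<Rightarrow> complex) \<Rightarrow> ('o \<Rightarrow> 'o \<Rightarrow> 'o \<Rightarrow> 'o \<Rightarrow> complex) \<Rightarrow>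
   nat \<Rightarrow> 'o ladder list \<Rightarrow> 'o state \<Rightarrow> 'o state" where
  "wick_V M v1 v2 \<xi> B \<psi> = (\<lambda>S.
     (\<Sum>\<^sub>\<infinity>(\<alpha>, \<beta>). v1 \<alpha> \<beta> * wick M \<xi> [Cre \<alpha>, Ann \<beta>] B \<psi> S)
   + (\<Sum>\<^sub>\<infinity>(\<alpha>, \<beta>, \<mu>, \<nu>). v2 \<alpha> \<beta> \<mu> \<nu> * wick M \<xi> [Cre \<alpha>, Cre \<beta>, Ann \<nu>, Ann \<mu>] B \<psi> S))"

definition O_string :: "'o list \<Rightarrow> 'o list \<Rightarrow> 'o ladder list" where
  "O_string \<alpha>s \<beta>s = map Cre \<alpha>s @ map Ann (rev \<beta>s)"

definition O_type ::
  "'o atom \<Rightarrow> 'o list \<Rightarrow> 'o list \<Rightarrow> orbital_type multiset \<times> orbital_type multiset" where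
  "O_type M \<alpha>s \<beta>s = (mset (map (kind M) \<alpha>s), mset (map (kind M) \<beta>s))"

definition QOP :: "'o::linorder atom \<Rightarrow> 'o list \<Rightarrow> 'o list \<Rightarrow> 'o state \<Rightarrow> 'o state" where
  "QOP M \<alpha>s \<beta>s \<psi> = projQ M (normal_ordered M (O_string \<alpha>s \<beta>s) (projP M \<psi>))"

text \<open>The labels of the operators in the \<open>n\<close>-body part of the wave operator: all-valence
  operators that change the parity are excluded.\<close>

definition wave_labels :: "'o atom \<Rightarrow> nat \<Rightarrow> ('o list \<times> 'o list) set" where
  "wave_labels M n = {(\<alpha>s, \<beta>s). length \<alpha>s = n \<and> length \<beta>s = n \<and>
     ((\<forall>\<gamma>\<in>set \<alpha>s \<union> set \<beta>s. kind M \<gamma> = Val) \<longrightarrow>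
       even (sum_list (map (ang M) \<alpha>s) + sum_list (map (ang M) \<beta>s)))}"

definition wave_part ::
  "'o::linorder atom \<Rightarrow> ('o list \<Rightarrow> 'o list \<Rightarrow> complex) \<Rightarrow> nat \<Rightarrow> 'o state \<Rightarrow> 'o state" where
  "wave_part M \<omega> n \<psi> = (\<lambda>S. \<Sum>\<^sub>\<infinity>(\<alpha>s, \<beta>s)\<in>wave_labels M n. \<omega> \<alpha>s \<beta>s * QOP M \<alpha>s \<beta>s \<psi> S)"

text \<open>The contribution of a single operator to \<open>W\<^sub>n\<^sub>,\<^sub>\<xi>\<close>. It depends on the expansion of the
  wave operator, that is on \<open>\<omega>\<close>, because contractions are defined on operator strings only.\<close>

definition W_term ::
  "'o::linorder atom \<Rightarrow> ('o \<Rightarrow> 'o \<Rightarrow> complex) \<Rightarrow> ('o \<Rightarrow> 'o \<Rightarrow> 'o \<Rightarrow> 'o \<Rightarrow> complex) \<Rightarrow>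
   ('o list \<Rightarrow> 'o list \<Rightarrow> complex) \<Rightarrow> nat \<Rightarrow> 'o list \<Rightarrow> 'o list \<Rightarrow> 'o state \<Rightarrow> 'o state" where
  "W_term M v1 v2 \<omega> \<xi> \<alpha>s \<beta>s \<psi> =
    (if \<exists>\<phi>\<in>hilbert_space M. QOP M \<alpha>s \<beta>s \<phi> \<noteq> (\<lambda>S. 0)
     then (\<lambda>S. \<omega> \<alpha>s \<beta>s * projP M (wick_V M v1 v2 \<xi> (O_string \<alpha>s \<beta>s) (projP M \<psi>)) S)
     else (\<lambda>S. 0))"

text \<open>The sum of the contributions to \<open>W\<^sub>n\<^sub>,\<^sub>\<xi>\<close> of the operators with labels in \<open>I\<close>;
  all of \<open>W\<^sub>n\<^sub>,\<^sub>\<xi>\<close> is obtained for the full label set.\<close>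

definition W_sum ::
  "'o::linorder atom \<Rightarrow> ('o \<Rightarrow> 'o \<Rightarrow> complex) \<Rightarrow> ('o \<Rightarrow> 'o \<Rightarrow> 'o \<Rightarrow> 'o \<Rightarrow> complex) \<Rightarrow>
   ('o list \<Rightarrow> 'o list \<Rightarrow> complex) \<Rightarrow> nat \<Rightarrow> ('o list \<times> 'o list) set \<Rightarrow> 'o state \<Rightarrow> 'o state" where
  "W_sum M v1 v2 \<omega> \<xi> I \<psi> = (\<lambda>S. \<Sum>\<^sub>\<infinity>(\<alpha>s, \<beta>s)\<in>I. W_term M v1 v2 \<omega> \<xi> \<alpha>s \<beta>s \<psi> S)"

definition W_part ::
  "'o::linorder atom \<Rightarrow> ('o \<Rightarrow> 'o \<Rightarrow> complex) \<Rightarrow> ('o \<Rightarrow> 'o \<Rightarrow> 'o \<Rightarrow> 'o \<Rightarrow> complex) \<Rightarrow>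
   ('o list \<Rightarrow> 'o list \<Rightarrow> complex) \<Rightarrow> nat \<Rightarrow> nat \<Rightarrow> 'o state \<Rightarrow> 'o state" where
  "W_part M v1 v2 \<omega> n \<xi> = W_sum M v1 v2 \<omega> \<xi> (wave_labels M n)"

definition effective_interaction ::
  "'o::linorder atom \<Rightarrow> ('o \<Rightarrow> 'o \<Rightarrow> complex) \<Rightarrow> ('o \<Rightarrow> 'o \<Rightarrow> 'o \<Rightarrow> 'o \<Rightarrow> complex) \<Rightarrow>
   ('o list \<Rightarrow> 'o list \<Rightarrow> complex) \<Rightarrow> 'o state \<Rightarrow> 'o state" where
  "effective_interaction M v1 v2 \<omega> \<psi> = (\<lambda>S. \<Sum>\<^sub>\<infinity>n. \<Sum>\<xi>\<le>4. W_part M v1 v2 \<omega> n \<xi> \<psi> S)"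

end

theory Submission
  imports Defs
begin

text \<open>Between model states a normal-ordered string survives only if all its operators are valence:
  core creators and excited annihilators kill the model space on the right, excited creators and
  core annihilators kill it on the left. In \<open>O\<close> the former must therefore be absent, and
  the latter must all be contracted. An excited creator contracts only with an annihilator of \<open>V\<close>
  and a core annihilator only with a creator of \<open>V\<close>, and \<open>V\<close> has at most two of each. So
  \<open>O\<close> has \<open>a \<le> 2\<close> excited creators, \<open>b \<le> 2\<close> core annihilators and
  otherwise valence operators, and \<open>a = b = 0\<close> is excluded because such an \<open>O\<close> of even
  parity maps the complete model space to itself.\<close>

section \<open>Transitions between determinants under operator strings\<close>

text \<open>\<open>hops xs S T\<close>: the string \<open>xs\<close> takes the determinant \<open>S\<close> to a nonzero multiple
  of \<open>T\<close>.\<close>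

fun hop :: "'o ladder \<Rightarrow> 'o set \<Rightarrow> 'o set \<Rightarrow> bool" where
  "hop (Cre \<alpha>) S T \<longleftrightarrow> \<alpha> \<notin> S \<and> T = insert \<alpha> S"
| "hop (Ann \<alpha>) S T \<longleftrightarrow> \<alpha> \<in> S \<and> T = S - {\<alpha>}"

primrec hops :: "'o ladder list \<Rightarrow> 'o set \<Rightarrow> 'o set \<Rightarrow> bool" where
  "hops [] S T \<longleftrightarrow> S = T"
| "hops (x # xs) S T \<longleftrightarrow> (\<exists>U. hops xs S U \<and> hop x U T)"

lemma hops_append: "hops (xs @ ys) S T \<longleftrightarrow> (\<exists>U. hops ys S U \<and> hops xs U T)"
  by (induction xs arbitrary: T) auto

lemma ladder_op_nonzero:
  assumes "ladder_op x \<psi> T \<noteq> 0"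
  shows "\<exists>S. \<psi> S \<noteq> 0 \<and> hop x S T"
proof (cases x)
  case (Cre \<alpha>)
  then show ?thesis
    using assms by (intro exI[of _ "T - {\<alpha>}"]) (auto split: if_splits)
next
  case (Ann \<alpha>)
  then show ?thesis
    using assms by (intro exI[of _ "insert \<alpha> T"]) (auto split: if_splits)
qed

lemma string_op_nonzero:
  assumes "string_op xs \<psi> T \<noteq> 0"
  shows "\<exists>S. \<psi> S \<noteq> 0 \<and> hops xs S T"
  using assms
proof (induction xs arbitrary: T)
  case Nil
  then show ?case by (simp add: string_op_def)
next
  case (Cons x xs)
  then have "ladder_op x (string_op xs \<psi>) T \<noteq> 0"
    by (simp add: string_op_def)
  then show ?case
    using Cons.IH by (meson hops.simps(2) ladder_op_nonzero)
qed

section \<open>Normal-ordered strings between closed-shell determinants\<close>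

text \<open>The part of \<open>model_configs\<close> that single valence operators preserve;
  electron number and parity may change from one operator of a string to the next.\<close>

definition closed_shell :: "'o atom \<Rightarrow> 'o set \<Rightarrow> bool" where
  "closed_shell M S \<longleftrightarrow> core M \<subseteq> S \<and> (\<forall>\<alpha>\<in>S. kind M \<alpha> \<noteq> Exc)"

text \<open>The strings here consist of core creators, blocked by the filled core, and of
  annihilators outside the core. Of the latter an excited one finds no electron, and a valence one
  keeps the shell closed, so the induction goes on.\<close>

lemma closed_shell_hops_annihilators:
  assumes "hops xs S T" "\<forall>x\<in>set xs. \<not> quasi_creator M x" "closed_shell M S"
  shows "closed_shell M T \<and> (\<forall>x\<in>set xs. \<exists>\<alpha>. x = Ann \<alpha> \<and> kind M \<alpha> = Val)"
  using assms
proof (induction xs arbitrary: T)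
  case Nil
  then show ?case by simp
next
  case (Cons x xs)
  then obtain U where "closed_shell M U" "hop x U T"
    and *: "\<forall>y\<in>set xs. \<exists>\<alpha>. y = Ann \<alpha> \<and> kind M \<alpha> = Val" by auto
  then have "closed_shell M T \<and> (\<exists>\<alpha>. x = Ann \<alpha> \<and> kind M \<alpha> = Val)"
    using Cons.prems(2)
    by (cases x; cases "kind M (case x of Cre \<alpha> \<Rightarrow> \<alpha> | Ann \<alpha> \<Rightarrow> \<alpha>)")
      (auto simp: closed_shell_def core_def)
  with * show ?case by simp
qed

text \<open>The mirror image, read backwards from \<open>T\<close>: an excited creator would leave
  an excited electron and a core annihilator a core hole. So the operator acting last creates a
  valence electron, and the determinant before it is closed as well.\<close>

lemma closed_shell_hops_creators:
  assumes "hops xs S T" "\<forall>x\<in>set xs. quasi_creator M x" "closed_shell M T"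
  shows "closed_shell M S \<and> (\<forall>x\<in>set xs. \<exists>\<alpha>. x = Cre \<alpha> \<and> kind M \<alpha> = Val)"
  using assms
proof (induction xs arbitrary: T)
  case Nil
  then show ?case by simp
next
  case (Cons x xs)
  then obtain U where U: "hops xs S U" "hop x U T" by auto
  then have *: "closed_shell M U \<and> (\<exists>\<alpha>. x = Cre \<alpha> \<and> kind M \<alpha> = Val)"
    using Cons.prems(2,3)
    by (cases x; cases "kind M (case x of Cre \<alpha> \<Rightarrow> \<alpha> | Ann \<alpha> \<Rightarrow> \<alpha>)")
      (auto simp: closed_shell_def core_def)
  then show ?case
    using Cons.IH[OF U(1)] Cons.prems(2) by simp
qed

text \<open>Splits the reordered string into the two blocks to which the closed-shell lemmas apply,
  the right block acting first.\<close>

lemma normal_ordered_nonzero: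
  assumes "normal_ordered M xs \<psi> T \<noteq> 0"
  obtains cs as S where "mset (cs @ as) = mset xs" "\<forall>x\<in>set cs. quasi_creator M x"
    "\<forall>x\<in>set as. \<not> quasi_creator M x" "\<psi> S \<noteq> 0" "hops (cs @ as) S T"
proof -
  let ?P = "\<lambda>i. quasi_creator M (xs ! i)"
  let ?cs = "map ((!) xs) (filter ?P [0..<length xs])"
  let ?as = "map ((!) xs) (filter (\<lambda>i. \<not> ?P i) [0..<length xs])"
  have "string_op (?cs @ ?as) \<psi> T \<noteq> 0"
    using assms by (auto simp: normal_ordered_def Let_def)
  then obtain S where "\<psi> S \<noteq> 0" "hops (?cs @ ?as) S T"
    using string_op_nonzero by blast
  moreover have "mset (?cs @ ?as) = mset (map ((!) xs) [0..<length xs])"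
    by (simp only: mset_append mset_map mset_filter flip: image_mset_union multiset_partition)
  then have "mset (?cs @ ?as) = mset xs" by (simp only: map_nth)
  ultimately show thesis
    by (intro that[of ?cs ?as S]) auto
qed

lemma normal_ordered_nonzero_annihilators:
  assumes "normal_ordered M xs \<psi> T \<noteq> 0" "\<And>S. \<psi> S \<noteq> 0 \<Longrightarrow> closed_shell M S"
    and "x \<in> set xs" "\<not> quasi_creator M x"
  shows "\<exists>\<alpha>. x = Ann \<alpha> \<and> kind M \<alpha> = Val"
proof -
  from assms(1) obtain cs as S U where *: "mset (cs @ as) = mset xs"
    "\<forall>x\<in>set cs. quasi_creator M x" "\<forall>x\<in>set as. \<not> quasi_creator M x" "\<psi> S \<noteq> 0" "hops as S U"
    by (elim normal_ordered_nonzero) (auto simp: hops_append)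
  then have "x \<in> set as" using assms(3,4) by (metis UnE set_append mset_eq_setD)
  then show ?thesis
    using closed_shell_hops_annihilators[OF *(5) *(3)] assms(2)[OF *(4)] by blast
qed

lemma normal_ordered_nonzero_creators:
  assumes "normal_ordered M xs \<psi> T \<noteq> 0" "closed_shell M T"
    and "x \<in> set xs" "quasi_creator M x"
  shows "\<exists>\<alpha>. x = Cre \<alpha> \<and> kind M \<alpha> = Val"
proof -
  from assms(1) obtain cs as S U where *: "mset (cs @ as) = mset xs"
    "\<forall>x\<in>set cs. quasi_creator M x" "\<forall>x\<in>set as. \<not> quasi_creator M x" "hops cs U T"
    by (elim normal_ordered_nonzero) (auto simp: hops_append)
  then have "x \<in> set cs" using assms(3,4) by (metis UnE set_append mset_eq_setD)
  then show ?thesis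
    using closed_shell_hops_creators[OF *(4) *(2)] assms(2) by blast
qed

section \<open>Contractions and vanishing Wick terms\<close>

lemma contraction_nonzero:
  assumes "contraction M x y \<noteq> 0"
  shows "hops [x, y] (core M) (core M)"
proof -
  obtain S where "slater (core M) S \<noteq> 0" "string_op [x, y] (slater (core M)) S \<noteq> 0"
    using assms unfolding contraction_def inner_prod_def
    by (metis (no_types, lifting) complex_cnj_zero infsum_0 mult_eq_0_iff)
  then show ?thesis
    using string_op_nonzero[of "[x, y]" "slater (core M)" S]
    by (fastforce simp: slater_def split: if_splits simp del: hops.simps)
qed

text \<open>The right operator acts first, and the left one must restore the core determinant: an
  excited electron is removed only by an annihilator, and (in the next lemma) a core hole is filled
  only by a creator.\<close>

lemma contraction_Exc:
  "contraction M x (Cre \<gamma>) \<noteq> 0 \<Longrightarrow> kind M \<gamma> = Exc \<Longrightarrow> \<exists>\<beta>. x = Ann \<beta>"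
  by (drule contraction_nonzero, cases x) (auto simp: core_def)

lemma contraction_Core:
  "contraction M x (Ann \<gamma>) \<noteq> 0 \<Longrightarrow> kind M \<gamma> = Core \<Longrightarrow> \<exists>\<alpha>. x = Cre \<alpha>"
  by (drule contraction_nonzero, cases x) (auto simp: core_def)

text \<open>A pigeonhole argument. \<open>F\<close> marks operators of \<open>B\<close> that cannot
  stay uncontracted, and \<open>G\<close> their possible partners in \<open>A\<close>. Both are left
  open to serve excited creators and core annihilators alike.\<close>

lemma wick_term_eq_0:
  assumes "closed_shell M S" and \<mu>: "\<mu> \<in> pairings (length A) (length B) \<xi>"
    and F: "\<And>y. y \<in> set B \<Longrightarrow> F y \<Longrightarrow> quasi_creator M y \<and> (\<nexists>\<alpha>. y = Cre \<alpha> \<and> kind M \<alpha> = Val)"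
    and G: "\<And>x y. x \<in> set A \<Longrightarrow> y \<in> set B \<Longrightarrow> F y \<Longrightarrow> contraction M x y \<noteq> 0 \<Longrightarrow> G x"
    and less: "length (filter G A) < length (filter F B)"
  shows "wick_term M A B \<mu> \<psi> S = 0"
proof (rule ccontr)
  let ?p = "length A"
  let ?free = "filter (\<lambda>i. i \<notin> fst ` \<mu> \<and> i \<notin> (+) ?p ` snd ` \<mu>) [0..<?p + length B]"
  let ?E = "{j. j < length B \<and> F (B ! j)}"
  assume "wick_term M A B \<mu> \<psi> S \<noteq> 0"
  then have prod: "(\<Prod>(i, j)\<in>\<mu>. contraction M (A ! i) (B ! j)) \<noteq> 0"
    and nz: "normal_ordered M (map ((!) (A @ B)) ?free) \<psi> S \<noteq> 0"
    by (auto simp: wick_term_def Let_def)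
  have sub: "\<mu> \<subseteq> {..<?p} \<times> {..<length B}" and inj: "inj_on fst \<mu>"
    using \<mu> by (auto simp: pairings_def)
  then have fin: "finite \<mu>" by (meson finite_SigmaI finite_lessThan finite_subset)
  have contr: "contraction M (A ! i) (B ! j) \<noteq> 0" if "(i, j) \<in> \<mu>" for i j
    using prod that fin by (auto simp: prod_zero_iff)
  \<comment> \<open>An uncontracted marked operator would remain in the normal-ordered rest, which
    then has no amplitude at the closed-shell \<open>S\<close>.\<close>
  have "?E \<subseteq> snd ` \<mu>"
  proof
    fix j assume j: "j \<in> ?E"
    show "j \<in> snd ` \<mu>"
    proof (rule ccontr)
      assume "j \<notin> snd ` \<mu>"
      then have "?p + j \<in> set ?free" using sub j by force
      then have "(A @ B) ! (?p + j) \<in> set (map ((!) (A @ B)) ?free)"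
        unfolding set_map by (rule imageI)
      then have "B ! j \<in> set (map ((!) (A @ B)) ?free)" by (simp only: nth_append_length_plus)
      then show False
        using normal_ordered_nonzero_creators[OF nz assms(1)] F[of "B ! j"] j by auto
    qed
  qed
  then have "?E \<subseteq> snd ` {z \<in> \<mu>. F (B ! snd z)}" by auto
  then have "card ?E \<le> card {z \<in> \<mu>. F (B ! snd z)}"
    by (rule surj_card_le[rotated]) (use fin in simp)
  \<comment> \<open>No operator of \<open>A\<close> is contracted twice, so the partners are
    distinct.\<close>
  also have "\<dots> = card (fst ` {z \<in> \<mu>. F (B ! snd z)})"
    by (rule card_image[symmetric]) (use inj in \<open>auto simp: inj_on_def\<close>)
  also have "\<dots> \<le> card {i. i < ?p \<and> G (A ! i)}"
  proof (rule card_mono)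
    show "fst ` {z \<in> \<mu>. F (B ! snd z)} \<subseteq> {i. i < ?p \<and> G (A ! i)}"
    proof clarify
      fix i j assume ij: "(i, j) \<in> \<mu>" "F (B ! snd (i, j))"
      then have "i < ?p" "j < length B" using sub by auto
      with ij contr show "fst (i, j) < ?p \<and> G (A ! fst (i, j))"
        using G[of "A ! i" "B ! j"] by simp
    qed
  qed simp
  finally show False
    using less by (simp add: length_filter_conv_card)
qed

lemma wick_V_eq_0:
  assumes "closed_shell M S"
    and "2 < count (mset (map (kind M) \<alpha>s)) Exc \<or> 2 < count (mset (map (kind M) \<beta>s)) Core"
  shows "wick_V M v1 v2 \<xi> (O_string \<alpha>s \<beta>s) \<psi> S = 0"
proof -
  let ?B = "O_string \<alpha>s \<beta>s"
  let ?e = "\<lambda>y. \<exists>\<gamma>. y = Cre \<gamma> \<and> kind M \<gamma> = Exc" and ?c = "\<lambda>y. \<exists>\<gamma>. y = Ann \<gamma> \<and> kind M \<gamma> = Core"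
  have count: "length (filter (\<lambda>x. kind M x = t) xs) = count (mset (map (kind M) xs)) t" for t xs
    by (induction xs) auto
  have lens: "length (filter ?e ?B) = count (mset (map (kind M) \<alpha>s)) Exc"
    "length (filter ?c ?B) = count (mset (map (kind M) \<beta>s)) Core"
    by (simp_all add: O_string_def filter_map o_def rev_filter[symmetric] count)
  \<comment> \<open>The bound of two creators and two annihilators covers the strings of
    \<open>V1\<close> and \<open>V2\<close> at once.\<close>
  have "wick M \<xi> A ?B \<psi> S = 0"
    if A: "length (filter (\<lambda>x. \<exists>\<gamma>. x = Ann \<gamma>) A) \<le> 2" "length (filter (\<lambda>x. \<exists>\<gamma>. x = Cre \<gamma>) A) \<le> 2"
    for A
    unfolding wick_def
  proof (rule sum.neutral, rule ballI)
    fix \<mu> assume \<mu>: "\<mu> \<in> pairings (length A) (length ?B) \<xi>"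
    from assms(2) show "wick_term M A ?B \<mu> \<psi> S = 0"
    proof
      assume "2 < count (mset (map (kind M) \<alpha>s)) Exc"
      then show ?thesis
        using A lens contraction_Exc
        by (intro wick_term_eq_0[OF assms(1) \<mu>, of ?e "\<lambda>x. \<exists>\<gamma>. x = Ann \<gamma>"]) auto
    next
      assume "2 < count (mset (map (kind M) \<beta>s)) Core"
      then show ?thesis
        using A lens contraction_Core
        by (intro wick_term_eq_0[OF assms(1) \<mu>, of ?c "\<lambda>x. \<exists>\<gamma>. x = Cre \<gamma>"]) auto
    qed
  qed
  then show ?thesis
    by (simp add: wick_V_def case_prod_unfold)
qed

section \<open>Electron number and parity under valence strings\<close>

text \<open>Creating or removing a valence electron shifts the electron number by one and in both
  cases flips the parity by (-1)^l. Annihilators are counted on the left-hand side to avoid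
  subtraction of naturals.\<close>

lemma hops_balance:
  assumes "hops xs S T" "\<forall>x\<in>set xs. \<exists>\<gamma>. (x = Cre \<gamma> \<or> x = Ann \<gamma>) \<and> kind M \<gamma> = Val"
    and "finite S" "closed_shell M S"
  shows "finite T \<and> closed_shell M T
    \<and> card T + size {#x \<in># mset xs. \<exists>\<gamma>. x = Ann \<gamma>#} = card S + size {#x \<in># mset xs. \<exists>\<gamma>. x = Cre \<gamma>#}
    \<and> config_parity M T
      = config_parity M S * (-1) ^ sum_mset (image_mset (case_ladder (ang M) (ang M)) (mset xs))"
  using assms
proof (induction xs arbitrary: T)
  case Nil
  then show ?case by simp
next
  case (Cons x xs)
  then obtain U where U: "hops xs S U" "hop x U T" by auto
  note IH = Cons.IH[OF U(1)]
  show ?case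
  proof (cases x)
    case (Cre \<gamma>)
    then show ?thesis
      using IH U(2) Cons.prems by (auto simp: closed_shell_def config_parity_def power_add)
  next
    case (Ann \<gamma>)
    then have T: "\<gamma> \<in> U" "T = U - {\<gamma>}" "kind M \<gamma> = Val" using U(2) Cons.prems by auto
    have "finite U" using IH Cons.prems by simp
    then have "card U = Suc (card T)"
      "(\<Sum>\<alpha>\<in>U. ang M \<alpha>) = ang M \<gamma> + (\<Sum>\<alpha>\<in>T. ang M \<alpha>)"
      unfolding T(2) using T(1) by (rule card.remove, rule sum.remove)
    \<comment> \<open>Removing an orbital divides by a sign, which is the same as multiplying by
      it.\<close>
    moreover from this have "config_parity M T = config_parity M U * (-1) ^ ang M \<gamma>"
      by (simp add: config_parity_def minus_one_power_iff)
    moreover have "closed_shell M T" "finite T"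
      using IH Cons.prems T by (auto simp: closed_shell_def core_def)
    ultimately show ?thesis
      using IH Cons.prems(2-4) Ann by (simp add: power_add mult_ac)
  qed
qed

section \<open>The model space projection on determinants\<close>

lemma projP_support:
  assumes "atomic_system M" "projP M \<psi> S \<noteq> 0"
  shows "S \<in> model_configs M"
proof -
  obtain k where "k \<in> {1..model_dim M}" "csf M k S \<noteq> 0"
    using assms(2) unfolding projP_def by (metis (no_types, lifting) mult_zero_right sum.neutral)
  then show ?thesis using assms(1) by (auto simp: atomic_system_def)
qed

lemma closed_shell_model_configs: "S \<in> model_configs M \<Longrightarrow> closed_shell M S"
  by (auto simp: model_configs_def closed_shell_def)

lemma inner_prod_support:
  assumes "finite A" "\<And>S. S \<notin> A \<Longrightarrow> \<phi> S = 0 \<or> \<psi> S = 0"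
  shows "inner_prod \<phi> \<psi> = (\<Sum>S\<in>A. cnj (\<phi> S) * \<psi> S)"
proof -
  have "inner_prod \<phi> \<psi> = (\<Sum>\<^sub>\<infinity>S\<in>A. cnj (\<phi> S) * \<psi> S)"
    unfolding inner_prod_def using assms(2) by (intro infsum_cong_neutral) auto
  with assms(1) show ?thesis by simp
qed

text \<open>Absolute summability follows by comparing ab with a^2 + b^2.\<close>

lemma hilbert_space_mult_summable:
  assumes "\<phi> \<in> hilbert_space M" "\<psi> \<in> hilbert_space M"
  shows "(\<lambda>S. cnj (\<phi> S) * \<psi> S) summable_on UNIV"
proof -
  have "(\<lambda>S. (cmod (\<phi> S))\<^sup>2 + (cmod (\<psi> S))\<^sup>2) summable_on UNIV"
    using assms by (intro summable_on_add) (auto simp: hilbert_space_def)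
  then have "(\<lambda>S. cnj (\<phi> S) * \<psi> S) abs_summable_on UNIV"
  proof (rule summable_on_comparison_test)
    fix S
    have "2 * (cmod (\<phi> S) * cmod (\<psi> S)) \<le> (cmod (\<phi> S))\<^sup>2 + (cmod (\<psi> S))\<^sup>2"
      using sum_squares_bound[of "cmod (\<phi> S)" "cmod (\<psi> S)"] by simp
    moreover have "0 \<le> cmod (\<phi> S) * cmod (\<psi> S)" by simp
    ultimately show "norm (cnj (\<phi> S) * \<psi> S) \<le> (cmod (\<phi> S))\<^sup>2 + (cmod (\<psi> S))\<^sup>2"
      unfolding norm_mult complex_mod_cnj by linarith
  qed simp
  then show ?thesis by (rule abs_summable_summable)
qed

lemma infsum_sum:
  fixes f :: "'i \<Rightarrow> 'a \<Rightarrow> 'b::{topological_comm_monoid_add, t2_space}"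
  assumes "\<And>i. i \<in> I \<Longrightarrow> f i summable_on A"
  shows "infsum (\<lambda>x. \<Sum>i\<in>I. f i x) A = (\<Sum>i\<in>I. infsum (f i) A)"
proof -
  have "((\<lambda>x. \<Sum>i\<in>I. f i x) has_sum (\<Sum>i\<in>I. infsum (f i) A)) A"
    using assms
    \<comment> \<open>For infinite \<open>I\<close> both sums over \<open>I\<close> default to
      zero.\<close>
    by (induction I rule: infinite_finite_induct) (auto intro!: has_sum_add)
  then show ?thesis by (rule infsumI)
qed

text \<open>Completeness puts the determinant in the span of the basis functions, and orthonormality
  determines the coefficients. In effect \<open>projP\<close> fixes each model determinant.\<close>

lemma slater_expansion:
  assumes M: "atomic_system M" and S: "S \<in> model_configs M"
  shows "(\<Sum>k=1..model_dim M. cnj (csf M k S) * csf M k S') = slater S S'"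
proof -
  obtain c where c: "slater S = (\<lambda>S'. \<Sum>k=1..model_dim M. c k * csf M k S')"
    using M S unfolding atomic_system_def by blast
  have idx: "k \<in> csf_index M" if "k \<in> {1..model_dim M}" for k
    using M that unfolding atomic_system_def by blast
  have hil: "csf M k \<in> hilbert_space M" if "k \<in> {1..model_dim M}" for k
    using M idx[OF that] unfolding atomic_system_def by blast
  have "c j = cnj (csf M j S)" if j: "j \<in> {1..model_dim M}" for j
  proof -
    have "cnj (csf M j S) = inner_prod (csf M j) (slater S)"
      by (subst inner_prod_support[of "{S}"]) (auto simp: slater_def)
    also have "\<dots> = (\<Sum>\<^sub>\<infinity>S'. \<Sum>k=1..model_dim M. c k * (cnj (csf M j S') * csf M k S'))"
      by (simp add: inner_prod_def c sum_distrib_left mult_ac)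
    also have "\<dots> = (\<Sum>k=1..model_dim M. \<Sum>\<^sub>\<infinity>S'. c k * (cnj (csf M j S') * csf M k S'))"
      by (intro infsum_sum summable_on_cmult_right hilbert_space_mult_summable[where M = M] hil j)
    also have "\<dots> = (\<Sum>k=1..model_dim M. c k * inner_prod (csf M j) (csf M k))"
      unfolding inner_prod_def
      by (intro sum.cong refl infsum_cmult_right hilbert_space_mult_summable[where M = M] hil j)
    also have "\<dots> = (\<Sum>k=1..model_dim M. if k = j then c k else 0)"
      using M idx j unfolding atomic_system_def by (intro sum.cong) auto
    also have "\<dots> = c j" using j by simp
    finally show ?thesis by simp
  qed
  then show ?thesis by (simp add: c)
qed

lemma finite_model_configs:
  assumes M: "atomic_system M"
  shows "finite (model_configs M)"
proof -
  \<comment> \<open>\<open>\<Sum>k. |csf k S|\<^sup>2\<close> is \<open>1\<close> for each \<open>S\<close>, and \<open>\<Sum>S. |csf k S|\<^sup>2\<close> is \<open>1\<close> for each \<open>k\<close>.\<close>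
  have norm: "cnj z * z = of_real ((cmod z)\<^sup>2)" for z
    by (metis complex_norm_square mult.commute)
  have "card F \<le> model_dim M" if F: "F \<subseteq> model_configs M" "finite F" for F
  proof -
    have "(of_nat (card F) :: complex) = (\<Sum>S\<in>F. \<Sum>k=1..model_dim M. cnj (csf M k S) * csf M k S)"
      using slater_expansion[OF M] F(1) by (simp add: slater_def subset_iff)
    also have "\<dots> = of_real (\<Sum>S\<in>F. \<Sum>k=1..model_dim M. (cmod (csf M k S))\<^sup>2)"
      by (simp only: norm of_real_sum)
    finally have "real (card F) = (\<Sum>S\<in>F. \<Sum>k=1..model_dim M. (cmod (csf M k S))\<^sup>2)"
      by (simp only: of_real_of_nat_eq flip: of_real_eq_iff[where 'a = complex])
    also have "\<dots> = (\<Sum>k=1..model_dim M. \<Sum>S\<in>F. (cmod (csf M k S))\<^sup>2)"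
      by (rule sum.swap)
    also have "\<dots> \<le> (\<Sum>k=1..model_dim M. 1)"
    proof (rule sum_mono)
      fix k assume "k \<in> {1..model_dim M}"
      then have k: "k \<in> csf_index M" using M unfolding atomic_system_def by blast
      have summ: "(\<lambda>S. (cmod (csf M k S))\<^sup>2) summable_on UNIV"
        using M k unfolding atomic_system_def hilbert_space_def by blast
      \<comment> \<open>Normalisation is a complex identity, so the real sum of squares is first
        embedded in the complex numbers.\<close>
      have "complex_of_real (\<Sum>\<^sub>\<infinity>S. (cmod (csf M k S))\<^sup>2) = inner_prod (csf M k) (csf M k)"
        unfolding inner_prod_def norm
        by (rule infsumI[symmetric]) (simp only: has_sum_of_real_iff has_sum_infsum summ)
      also have "\<dots> = 1" using M k unfolding atomic_system_def by simp
      finally have "(\<Sum>\<^sub>\<infinity>S. (cmod (csf M k S))\<^sup>2) = 1" by simp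
      then show "(\<Sum>S\<in>F. (cmod (csf M k S))\<^sup>2) \<le> 1"
        using finite_sum_le_infsum[OF summ F(2)] by simp
    qed
    finally show ?thesis by simp
  qed
  then show ?thesis by (meson finite_if_finite_subsets_card_bdd)
qed

text \<open>Since \<open>projP\<close> fixes each model determinant, it fixes all their
  combinations. There are finitely many of them, so the inner products are finite sums and may be
  exchanged with the sum over \<open>k\<close>.\<close>

lemma projQ_eq_0:
  assumes M: "atomic_system M" and \<chi>: "\<And>S. \<chi> S \<noteq> 0 \<Longrightarrow> S \<in> model_configs M"
  shows "projQ M \<chi> = (\<lambda>S. 0)"
proof
  fix S
  let ?C = "model_configs M"
  have "projP M \<chi> S = (\<Sum>k=1..model_dim M. (\<Sum>S'\<in>?C. cnj (csf M k S') * \<chi> S') * csf M k S)"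
    unfolding projP_def using finite_model_configs[OF M] \<chi> by (subst inner_prod_support) blast+
  also have "\<dots> = (\<Sum>S'\<in>?C. \<chi> S' * (\<Sum>k=1..model_dim M. cnj (csf M k S') * csf M k S))"
    unfolding sum_distrib_left sum_distrib_right
    by (subst sum.swap) (simp add: mult_ac)
  also have "\<dots> = (\<Sum>S'\<in>?C. if S = S' then \<chi> S' else 0)"
    by (intro sum.cong) (auto simp: slater_expansion[OF M, unfolded One_nat_def] slater_def)
  also have "\<dots> = \<chi> S" using finite_model_configs[OF M] \<chi>[of S] by auto
  finally show "projQ M \<chi> S = 0" by (simp add: projQ_def)
qed

section \<open>Operators with nonvanishing \<open>QOP\<close>\<close>

text \<open>The parity selection rule: equally many creators and annihilators keep the electron
  number, and an even sum of angular momenta keeps the parity. So the image stays on model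
  configurations, where \<open>projQ\<close> vanishes.\<close>

lemma QOP_valence_eq_0:
  assumes M: "atomic_system M" and lab: "(\<alpha>s, \<beta>s) \<in> wave_labels M n"
    and val: "\<forall>\<gamma>\<in>set \<alpha>s \<union> set \<beta>s. kind M \<gamma> = Val"
  shows "QOP M \<alpha>s \<beta>s \<phi> = (\<lambda>S. 0)"
  unfolding QOP_def
proof (rule projQ_eq_0[OF M])
  fix T assume "normal_ordered M (O_string \<alpha>s \<beta>s) (projP M \<phi>) T \<noteq> 0"
  \<comment> \<open>Only the multiset of the reordered string is kept: the counts in
    \<open>hops_balance\<close> do not depend on the order.\<close>
  then obtain xs S where xs: "mset xs = mset (O_string \<alpha>s \<beta>s)" "projP M \<phi> S \<noteq> 0" "hops xs S T"
    by (metis normal_ordered_nonzero)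
  have S: "S \<in> model_configs M" using projP_support[OF M xs(2)] .
  have "set xs = set (O_string \<alpha>s \<beta>s)" using xs(1) by (rule mset_eq_setD)
  then have "\<forall>x\<in>set xs. \<exists>\<gamma>. (x = Cre \<gamma> \<or> x = Ann \<gamma>) \<and> kind M \<gamma> = Val"
    using val by (auto simp: O_string_def)
  note bal = hops_balance[OF xs(3) this _ closed_shell_model_configs[OF S]]
  have "length \<alpha>s = length \<beta>s" using lab by (simp add: wave_labels_def)
  moreover have "size {#x \<in># mset xs. \<exists>\<gamma>. x = Cre \<gamma>#} = length \<alpha>s"
    "size {#x \<in># mset xs. \<exists>\<gamma>. x = Ann \<gamma>#} = length \<beta>s"
    unfolding xs(1) mset_filter[symmetric] size_mset by (simp_all add: O_string_def filter_map o_def)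
  moreover have "sum_mset (image_mset (case_ladder (ang M) (ang M)) (mset xs))
      = sum_list (map (ang M) \<alpha>s) + sum_list (map (ang M) \<beta>s)"
    unfolding xs(1) mset_map[symmetric] sum_mset_sum_list
    by (simp add: O_string_def o_def sum_list.rev flip: rev_map)
  moreover have "even (sum_list (map (ang M) \<alpha>s) + sum_list (map (ang M) \<beta>s))"
    using lab val by (simp add: wave_labels_def)
  ultimately show "T \<in> model_configs M"
    using bal S by (auto simp: model_configs_def closed_shell_def)
qed

lemma QOP_nonzero_types:
  assumes M: "atomic_system M" and "QOP M \<alpha>s \<beta>s \<phi> \<noteq> (\<lambda>S. 0)"
  shows "\<forall>\<gamma>\<in>set \<alpha>s. kind M \<gamma> \<noteq> Core" "\<forall>\<gamma>\<in>set \<beta>s. kind M \<gamma> \<noteq> Exc"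
proof -
  \<comment> \<open>If all amplitudes vanished, \<open>projQ_eq_0\<close> would apply with empty
    support.\<close>
  have "\<exists>T. normal_ordered M (O_string \<alpha>s \<beta>s) (projP M \<phi>) T \<noteq> 0"
    using projQ_eq_0[OF M] assms(2) unfolding QOP_def by metis
  then obtain T where T: "normal_ordered M (O_string \<alpha>s \<beta>s) (projP M \<phi>) T \<noteq> 0" ..
  note ann = normal_ordered_nonzero_annihilators[OF T
      closed_shell_model_configs[OF projP_support[OF M]]]
  show "\<forall>\<gamma>\<in>set \<alpha>s. kind M \<gamma> \<noteq> Core"
  proof
    fix \<gamma> assume "\<gamma> \<in> set \<alpha>s"
    then show "kind M \<gamma> \<noteq> Core"
      using ann[where x = "Cre \<gamma>"] by (auto simp: O_string_def)
  qed
  show "\<forall>\<gamma>\<in>set \<beta>s. kind M \<gamma> \<noteq> Exc"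
  proof
    fix \<gamma> assume "\<gamma> \<in> set \<beta>s"
    then show "kind M \<gamma> \<noteq> Exc"
      using ann[where x = "Ann \<gamma>"] by (auto simp: O_string_def)
  qed
qed

text \<open>The basis functions live on model configurations, so their inner products see \<chi>
  only there.\<close>

lemma projP_eq_0:
  assumes M: "atomic_system M" and "\<And>S. S \<in> model_configs M \<Longrightarrow> \<chi> S = 0"
  shows "projP M \<chi> = (\<lambda>S. 0)"
proof -
  have "csf M k S = 0 \<or> \<chi> S = 0" if "k \<in> {1..model_dim M}" for k S
    using M assms(2) that unfolding atomic_system_def by blast
  then have "inner_prod (csf M k) \<chi> = 0" if "k \<in> {1..model_dim M}" for k
    using that inner_prod_support[of "{}" "csf M k" \<chi>] by simp
  then show ?thesis by (simp add: projP_def)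
qed

section \<open>Counting the types\<close>

lemma mset_two_values:
  assumes "set_mset A \<subseteq> {x, y}" "x \<noteq> y"
  shows "A = replicate_mset (count A x) x + replicate_mset (size A - count A x) y"
proof -
  have "A = replicate_mset (count A x) x + replicate_mset (count A y) y"
    using assms by (intro multiset_eqI) (auto simp: not_in_iff[symmetric])
  moreover from this have "size A = count A x + count A y"
    by (metis size_union size_replicate_mset)
  ultimately show ?thesis by simp
qed

theorem mainTheorem1:
  fixes M :: "'o::{countable, linorder} atom"
    and v1 :: "'o \<Rightarrow> 'o \<Rightarrow> complex"
    and v2 :: "'o \<Rightarrow> 'o \<Rightarrow> 'o \<Rightarrow> 'o \<Rightarrow> complex"
    and \<omega> :: "'o list \<Rightarrow> 'o list \<Rightarrow> complex"
    and n :: nat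
  assumes "atomic_system M" and "n \<ge> 2"
  shows "\<exists>T :: (orbital_type multiset \<times> orbital_type multiset) set.
    finite T \<and> card T \<le> 8 \<and>
    (\<forall>\<xi>\<in>{1..4}. \<forall>(\<alpha>s, \<beta>s)\<in>wave_labels M n.
      (\<exists>\<psi>\<in>hilbert_space M. W_term M v1 v2 \<omega> \<xi> \<alpha>s \<beta>s \<psi> \<noteq> (\<lambda>S. 0)) \<longrightarrow> O_type M \<alpha>s \<beta>s \<in> T) \<and>
    (\<forall>\<xi>\<le>4. \<forall>\<psi>\<in>hilbert_space M. W_part M v1 v2 \<omega> n \<xi> \<psi> =
      W_sum M v1 v2 \<omega> \<xi> {(\<alpha>s, \<beta>s)\<in>wave_labels M n. O_type M \<alpha>s \<beta>s \<in> T} \<psi>)"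
proof -
  \<comment> \<open>Here \<open>a\<close> counts excited creators and \<open>b\<close> core
    annihilators; the other operators are valence.\<close>
  define type_of where "type_of = (\<lambda>(a, b). (replicate_mset a Exc + replicate_mset (n - a) Val,
    replicate_mset b Core + replicate_mset (n - b) Val))"
  \<comment> \<open>Nine pairs with entries at most two, less the all-valence one, leave
    eight.\<close>
  define T where "T = type_of ` ({..2} \<times> {..2} - {(0, 0)})"
  have fin: "finite T" by (simp add: T_def)
  have "card T \<le> card ({..2::nat} \<times> {..2::nat} - {(0, 0)})"
    unfolding T_def by (rule card_image_le) simp
  then have card: "card T \<le> 8" by simp
  have main: "O_type M \<alpha>s \<beta>s \<in> T"
    if lab: "(\<alpha>s, \<beta>s) \<in> wave_labels M n" and W: "W_term M v1 v2 \<omega> \<xi> \<alpha>s \<beta>s \<psi> \<noteq> (\<lambda>S. 0)"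
    for \<alpha>s \<beta>s \<xi> \<psi>
  proof -
    let ?A = "mset (map (kind M) \<alpha>s)" and ?B = "mset (map (kind M) \<beta>s)"
    obtain \<phi> where \<phi>: "QOP M \<alpha>s \<beta>s \<phi> \<noteq> (\<lambda>S. 0)"
      using W by (auto simp: W_term_def split: if_splits)
    have "projP M (wick_V M v1 v2 \<xi> (O_string \<alpha>s \<beta>s) (projP M \<psi>)) \<noteq> (\<lambda>S. 0)"
      using W by (auto simp: W_term_def split: if_splits)
    \<comment> \<open>A nonzero projection needs an amplitude on a model configuration; this is
      closed-shell, so \<open>wick_V_eq_0\<close> bounds both counts by two.\<close>
    then obtain S where "S \<in> model_configs M"
      "wick_V M v1 v2 \<xi> (O_string \<alpha>s \<beta>s) (projP M \<psi>) S \<noteq> 0"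
      using projP_eq_0[OF assms(1)] by blast
    then have le: "count ?A Exc \<le> 2" "count ?B Core \<le> 2"
      using wick_V_eq_0[OF closed_shell_model_configs] by (meson not_less)+
    have sub: "set_mset ?A \<subseteq> {Exc, Val}" "set_mset ?B \<subseteq> {Core, Val}"
      using QOP_nonzero_types[OF assms(1) \<phi>] by (auto intro: orbital_type.exhaust[of "kind M _"])
    have "(count ?A Exc, count ?B Core) \<noteq> (0, 0)"
    proof
      assume "(count ?A Exc, count ?B Core) = (0, 0)"
      then have "Exc \<notin># ?A" "Core \<notin># ?B" by (simp_all only: prod.inject not_in_iff)
      then have "\<forall>\<gamma>\<in>set \<alpha>s \<union> set \<beta>s. kind M \<gamma> = Val"
        using sub by (fastforce simp: image_iff)
      then show False using QOP_valence_eq_0[OF assms(1) lab] \<phi> by blast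
    qed
    moreover have "O_type M \<alpha>s \<beta>s = type_of (count ?A Exc, count ?B Core)"
      using mset_two_values[OF sub(1)] mset_two_values[OF sub(2)] lab
      by (simp add: O_type_def type_of_def wave_labels_def)
    ultimately show ?thesis using le unfolding T_def by blast
  qed
  \<comment> \<open>By \<open>main\<close> every label with type outside \<open>T\<close>
    contributes a zero summand, so the two infinite sums agree without any convergence
    argument.\<close>
  have "W_part M v1 v2 \<omega> n \<xi> \<psi> =
      W_sum M v1 v2 \<omega> \<xi> {(\<alpha>s, \<beta>s)\<in>wave_labels M n. O_type M \<alpha>s \<beta>s \<in> T} \<psi>" for \<xi> \<psi>
    unfolding W_part_def W_sum_def using main
    by (intro ext infsum_cong_neutral) (auto, metis)
  with fin card main show ?thesis by (intro exI[of _ T]) blast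
qed

end
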